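(* For every even integer $n \geq 16$, there exists a connected cubic graph of order $n$ that admits a non-equitable $4$-total coloring.
   Context: All graphs are finite, simple and cubic ($3$-regular). The order of a graph is its number of vertices. A $4$-total coloring of $G$ assigns one of the four colors $1,2,3,4$ to each vertex and each edge of $G$ so that adjacent vertices receive distinct colors, adjacent edges (edges sharing an endpoint) receive distinct colors, and every vertex and edge that are incident receive distinct colors. The color class $c_i$ is the set of all vertices and edges of color $i$. The coloring is equitable if $\bigl||c_i|-|c_j|\bigr| \le 1$ for all $i,j \in \{1,2,3,4\}$, and non-equitable otherwise. *)

theory Defs
  imports Main
begin

text \<open>A graph is given by its vertex set and its set of edges; an edge is the two-element set of
  its endpoints, so that loops and parallel edges do not arise.\<close>

definition simple_graph :: "'a set \<Rightarrow> 'a set set \<Rightarrow> bool" where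
  "simple_graph V E \<longleftrightarrow> finite V \<and> (\<forall>e\<in>E. e \<subseteq> V \<and> card e = 2)"

definition degree :: "'a set set \<Rightarrow> 'a \<Rightarrow> nat" where
  "degree E v = card {e \<in> E. v \<in> e}"

definition cubic_graph :: "'a set \<Rightarrow> 'a set set \<Rightarrow> bool" where
  "cubic_graph V E \<longleftrightarrow> simple_graph V E \<and> (\<forall>v\<in>V. degree E v = 3)"

definition connected_graph :: "'a set \<Rightarrow> 'a set set \<Rightarrow> bool" where
  "connected_graph V E \<longleftrightarrow> V \<noteq> {} \<and> (\<forall>u\<in>V. \<forall>v\<in>V. (u, v) \<in> {(x, y). {x, y} \<in> E}\<^sup>*)"

text \<open>A total coloring colors vertices and edges simultaneously, hence is a function on the
  disjoint sum: \<open>c (Inl v)\<close> is the color of the vertex \<open>v\<close> and \<open>c (Inr e)\<close> that of the edge \<open>e\<close>.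
  Values outside \<open>V <+> E\<close> are irrelevant.\<close>

definition total_coloring ::
  "nat \<Rightarrow> 'a set \<Rightarrow> 'a set set \<Rightarrow> ('a + 'a set \<Rightarrow> nat) \<Rightarrow> bool" where
  "total_coloring k V E c \<longleftrightarrow>
     (\<forall>x \<in> V <+> E. c x \<in> {1..k}) \<and>
     (\<forall>u\<in>V. \<forall>v\<in>V. {u, v} \<in> E \<longrightarrow> c (Inl u) \<noteq> c (Inl v)) \<and>
     (\<forall>e\<in>E. \<forall>f\<in>E. e \<noteq> f \<and> e \<inter> f \<noteq> {} \<longrightarrow> c (Inr e) \<noteq> c (Inr f)) \<and>
     (\<forall>v\<in>V. \<forall>e\<in>E. v \<in> e \<longrightarrow> c (Inl v) \<noteq> c (Inr e))"

definition color_class ::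
  "'a set \<Rightarrow> 'a set set \<Rightarrow> ('a + 'a set \<Rightarrow> nat) \<Rightarrow> nat \<Rightarrow> ('a + 'a set) set" where
  "color_class V E c i = {x \<in> V <+> E. c x = i}"

definition equitable ::
  "nat \<Rightarrow> 'a set \<Rightarrow> 'a set set \<Rightarrow> ('a + 'a set \<Rightarrow> nat) \<Rightarrow> bool" where
  "equitable k V E c \<longleftrightarrow>
     (\<forall>i\<in>{1..k}. \<forall>j\<in>{1..k}.
        \<bar>int (card (color_class V E c i)) - int (card (color_class V E c j))\<bar> \<le> 1)"

end

theory Submission
  imports Defs
begin

text \<open>In a 4-total coloring of a cubic graph every vertex meets every color exactly once, either by
  being colored with it or through one incident edge. So a color \<open>i\<close> is an involution \<open>N i\<close> of
  the vertex set, whose fixed points are the vertices of color \<open>i\<close>. With \<open>f\<^sub>i\<close> fixed points the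
  color class has \<open>(n + f\<^sub>i) / 2\<close> elements, and the coloring is non-equitable as soon as
  \<open>f\<^sub>0 \<ge> f\<^sub>2 + 4\<close>.

  Two such graphs can be joined by removing an edge of color \<open>3\<close> with ends of colors \<open>0\<close> and \<open>1\<close>
  from each of them and reconnecting crosswise, which adds up the \<open>f\<^sub>i\<close>. The triangular prism has a
  coloring with \<open>(f\<^sub>0, f\<^sub>1, f\<^sub>2, f\<^sub>3) = (2, 2, 0, 2)\<close>. Joining \<open>k\<close> prisms to graphs of order 6, 8 and 10
  with \<open>f\<^sub>0 - f\<^sub>2 = 2, 0, 2\<close> gives \<open>f\<^sub>0 - f\<^sub>2\<close> equal to \<open>2 k + 2\<close>, \<open>2 k\<close> and \<open>2 k + 2\<close>, which is at
  least 4 for all even orders from 16 on.\<close>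

section \<open>Total colorings as families of involutions\<close>

definition fixed_points :: "nat \<Rightarrow> (nat \<Rightarrow> nat) \<Rightarrow> nat set" where
  "fixed_points n f = {w. w < n \<and> f w = w}"

definition involution_edges :: "nat \<Rightarrow> (nat \<Rightarrow> nat) \<Rightarrow> nat set set" where
  "involution_edges n f = {{w, f w} | w. w < n \<and> f w \<noteq> w}"

text \<open>The sets in \<open>involution_edges\<close> are the two-element orbits of
  \<open>f\<close>; they partition the points that \<open>f\<close> moves.\<close>

lemma card_fixed_points_involution_edges:
  assumes "\<And>w. w < n \<Longrightarrow> f w < n" "\<And>w. w < n \<Longrightarrow> f (f w) = w"
  shows "card (fixed_points n f) + 2 * card (involution_edges n f) = n"
proof -
  have U: "\<Union> (involution_edges n f) = {..<n} - fixed_points n f"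
    using assms by (auto simp: involution_edges_def fixed_points_def)
  have "involution_edges n f \<subseteq> Pow {..<n}"
    using assms by (auto simp: involution_edges_def)
  then have fin: "finite (involution_edges n f)"
    by (rule finite_subset) simp
  have "2 * card (involution_edges n f) = card (\<Union> (involution_edges n f))"
  proof (rule card_partition[OF fin])
    show "finite (\<Union> (involution_edges n f))" by (simp add: U)
    show "card e = 2" if "e \<in> involution_edges n f" for e
      using that by (auto simp: involution_edges_def card_2_iff)
    show "d \<inter> e = {}" if "d \<in> involution_edges n f" "e \<in> involution_edges n f" "d \<noteq> e" for d e
    proof -
      have "c = {x, f x}" if "c \<in> involution_edges n f" "x \<in> c" for c x
        using that assms(2) by (auto simp: involution_edges_def)
      then show ?thesis using that by blast
    qed
  qed
  also have "\<dots> = n - card (fixed_points n f)"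
    unfolding U by (subst card_Diff_subset) (auto simp: fixed_points_def)
  finally have "2 * card (involution_edges n f) = n - card (fixed_points n f)" .
  moreover have "card (fixed_points n f) \<le> card {..<n}"
    by (rule card_mono) (auto simp: fixed_points_def)
  ultimately show ?thesis by simp
qed

text \<open>As the four values at \<open>w\<close> differ, exactly one of them is \<open>w\<close>
  itself and the others are three different neighbors, which makes the graph simple and cubic.
  \<open>proper\<close> rules out a neighbor \<open>N j w\<close> that shares the color
  \<open>i\<close> of \<open>w\<close>; its conclusion \<open>i = j\<close> allows for the case
  \<open>N j w = w\<close>.\<close>

locale coloring_involutions =
  fixes n :: nat and N :: "nat \<Rightarrow> nat \<Rightarrow> nat"
  assumes bounded: "i < 4 \<Longrightarrow> w < n \<Longrightarrow> N i w < n"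
    and involution: "i < 4 \<Longrightarrow> w < n \<Longrightarrow> N i (N i w) = w"
    and ex_fixing: "w < n \<Longrightarrow> \<exists>i<4. N i w = w"
    and distinct_colors: "i < 4 \<Longrightarrow> j < 4 \<Longrightarrow> w < n \<Longrightarrow> N i w = N j w \<Longrightarrow> i = j"
    and proper: "i < 4 \<Longrightarrow> j < 4 \<Longrightarrow> w < n \<Longrightarrow> N i w = w \<Longrightarrow> N i (N j w) = N j w \<Longrightarrow> i = j"
begin

definition edges :: "nat set set" where
  "edges = (\<Union>i<4. involution_edges n (N i))"

text \<open>The involutions are indexed from \<open>0\<close> but the colors start at
  \<open>1\<close>, hence the \<open>Suc\<close>.\<close>

definition coloring :: "nat + nat set \<Rightarrow> nat" where
  "coloring x = Suc (case x of
      Inl w \<Rightarrow> (THE i. i < 4 \<and> N i w = w)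
    | Inr e \<Rightarrow> (THE i. i < 4 \<and> e \<in> involution_edges n (N i)))"

lemma coloring_vertex: "i < 4 \<Longrightarrow> w < n \<Longrightarrow> N i w = w \<Longrightarrow> coloring (Inl w) = Suc i"
  unfolding coloring_def by (auto intro!: the_equality intro: distinct_colors[of _ i w])

lemma involution_edges_mem:
  assumes "i < 4" "e \<in> involution_edges n (N i)" "x \<in> e"
  shows "x < n" "N i x \<noteq> x" "e = {x, N i x}"
  using assms bounded involution by (auto simp: involution_edges_def)

text \<open>An edge with two colors would give one of its ends the same partner under both
  involutions, against \<open>distinct_colors\<close>.\<close>

lemma involution_edges_disjoint:
  assumes "i < 4" "j < 4" "e \<in> involution_edges n (N i)" "e \<in> involution_edges n (N j)"
  shows "i = j"
proof -
  obtain x where x: "x \<in> e" using assms(3) by (auto simp: involution_edges_def)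
  have "{x, N i x} = {x, N j x}"
    using involution_edges_mem[OF assms(1,3) x] involution_edges_mem[OF assms(2,4) x] by simp
  then have "N i x = N j x" by (metis doubleton_eq_iff)
  then show ?thesis
    using distinct_colors assms(1,2) involution_edges_mem(1)[OF assms(1,3) x] by blast
qed

lemma coloring_edge: "i < 4 \<Longrightarrow> e \<in> involution_edges n (N i) \<Longrightarrow> coloring (Inr e) = Suc i"
  unfolding coloring_def by (auto intro!: the_equality intro: involution_edges_disjoint)

lemma color_class_eq:
  assumes "i < 4"
  shows "color_class {..<n} edges coloring (Suc i)
    = fixed_points n (N i) <+> involution_edges n (N i)" (is "?L = ?R")
proof
  show "?R \<subseteq> ?L"
    using assms by (auto simp: color_class_def edges_def fixed_points_def coloring_vertex coloring_edge)
  show "?L \<subseteq> ?R"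
  proof
    fix x assume x: "x \<in> ?L"
    then have c: "coloring x = Suc i" and "x \<in> {..<n} <+> edges"
      by (auto simp: color_class_def)
    then consider w where "x = Inl w" "w < n" | e j where "x = Inr e" "j < 4" "e \<in> involution_edges n (N j)"
      by (auto simp: edges_def)
    then show "x \<in> ?R"
    proof cases
      case 1
      then obtain j where "j < 4" "N j w = w" using ex_fixing by blast
      then show ?thesis using c 1 coloring_vertex by (auto simp: fixed_points_def)
    next
      case 2
      then show ?thesis using c coloring_edge by auto
    qed
  qed
qed

lemma double_card_color_class:
  assumes "i < 4"
  shows "2 * card (color_class {..<n} edges coloring (Suc i)) = n + card (fixed_points n (N i))"
proof -
  have "involution_edges n (N i) \<subseteq> Pow {..<n}"
    using assms bounded by (auto simp: involution_edges_def)
  then have "finite (involution_edges n (N i))"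
    by (rule finite_subset) simp
  moreover have "finite (fixed_points n (N i))" by (simp add: fixed_points_def)
  ultimately show ?thesis
    using card_fixed_points_involution_edges[of n "N i"] assms bounded involution
    by (simp add: color_class_eq card_Plus)
qed

text \<open>Class sizes differ by half the difference of the fixed-point counts, so a gap of 4 there
  is a gap of at least 2 here.\<close>

lemma not_equitable_coloring:
  assumes "card (fixed_points n (N 0)) \<ge> card (fixed_points n (N 2)) + 4"
  shows "\<not> equitable 4 {..<n} edges coloring"
proof
  assume "equitable 4 {..<n} edges coloring"
  then have "\<bar>int (card (color_class {..<n} edges coloring (Suc 0)))
      - int (card (color_class {..<n} edges coloring (Suc 2)))\<bar> \<le> 1"
    unfolding equitable_def by auto
  then show False
    using double_card_color_class[of 0] double_card_color_class[of 2] assms by linarith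
qed

section \<open>Regularity, properness and connectedness\<close>

lemma incident_edges:
  assumes "v < n"
  shows "{e \<in> edges. v \<in> e} = (\<lambda>i. {v, N i v}) ` {i. i < 4 \<and> N i v \<noteq> v}"
proof (intro equalityI subsetI)
  fix e assume "e \<in> {e \<in> edges. v \<in> e}"
  then obtain i where "i < 4" "e \<in> involution_edges n (N i)" "v \<in> e" by (auto simp: edges_def)
  then show "e \<in> (\<lambda>i. {v, N i v}) ` {i. i < 4 \<and> N i v \<noteq> v}"
    using involution_edges_mem[of i e v] by blast
qed (use assms in \<open>auto simp: edges_def involution_edges_def\<close>)

lemma degree_edges:
  assumes "v < n"
  shows "degree edges v = 3"
proof -
  obtain k where k: "k < 4" "N k v = v" using ex_fixing assms by blast
  have "{i. i < 4 \<and> N i v \<noteq> v} = {..<4} - {k}"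
    using k assms by (auto intro: distinct_colors[of _ k v])
  moreover have "inj_on (\<lambda>i. {v, N i v}) {i. i < 4 \<and> N i v \<noteq> v}"
    using assms by (auto simp: inj_on_def doubleton_eq_iff intro: distinct_colors[of _ _ v])
  ultimately show ?thesis
    unfolding degree_def incident_edges[OF assms] using k(1) by (simp add: card_image)
qed

lemma cubic_graph_edges: "cubic_graph {..<n} edges"
proof -
  have "e \<subseteq> {..<n} \<and> card e = 2" if "e \<in> edges" for e
    using that bounded by (auto simp: edges_def involution_edges_def)
  then show ?thesis using degree_edges by (auto simp: cubic_graph_def simple_graph_def)
qed

lemma total_coloring_edges: "total_coloring 4 {..<n} edges coloring"
proof -
  \<comment> \<open>Seen from any of its ends \<open>x\<close>, an edge is determined by
    \<open>x\<close> and its color. Every conflict at \<open>x\<close> thus becomes a statement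
    about the values \<open>N i x\<close>.\<close>
  have edge: "\<exists>i<4. e = {x, N i x} \<and> N i x \<noteq> x \<and> coloring (Inr e) = Suc i"
    if e: "e \<in> edges" "x \<in> e" for e x
  proof -
    obtain i where "i < 4" "e \<in> involution_edges n (N i)" using e(1) by (auto simp: edges_def)
    then show ?thesis using involution_edges_mem[of i e x] coloring_edge[of i e] e(2) by blast
  qed
  have vertex: "\<exists>i<4. N i w = w \<and> coloring (Inl w) = Suc i" if "w < n" for w
    using ex_fixing[OF that] coloring_vertex that by blast
  have "coloring x \<in> {1..4}" if "x \<in> {..<n} <+> edges" for x
    using that
  proof
    fix w assume "x = Inl w" "w \<in> {..<n}"
    then show ?thesis using vertex[of w] by auto
  next
    fix e assume e: "x = Inr e" "e \<in> edges"
    then obtain y where "y \<in> e" by (auto simp: edges_def involution_edges_def)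
    then show ?thesis using e edge[of e y] by auto
  qed
  moreover have "coloring (Inl u) \<noteq> coloring (Inl v)" if uv: "u < n" "v < n" "{u, v} \<in> edges" for u v
  proof
    assume eq: "coloring (Inl u) = coloring (Inl v)"
    obtain i where i: "i < 4" "N i u = u" "coloring (Inl u) = Suc i" using vertex \<open>u < n\<close> by blast
    obtain j where j: "j < 4" "N j v = v" "coloring (Inl v) = Suc j" using vertex \<open>v < n\<close> by blast
    obtain k where k: "k < 4" "{u, v} = {u, N k u}" "N k u \<noteq> u" using edge[of "{u, v}" u] uv(3) by blast
    have "v = N k u" using k by (metis doubleton_eq_iff)
    \<comment> \<open>Equal colors give \<open>i = j\<close>, and then \<open>proper\<close> gives
      \<open>i = k\<close>; but \<open>N i u\<close> is \<open>u\<close> while \<open>N k u\<close>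
      is not.\<close>
    then show False using proper[of i k u] i j k eq \<open>u < n\<close> by auto
  qed
  moreover have "coloring (Inr e) \<noteq> coloring (Inr f)"
    if ef: "e \<in> edges" "f \<in> edges" "e \<noteq> f" "e \<inter> f \<noteq> {}" for e f
  proof -
    obtain x where "x \<in> e" "x \<in> f" using ef by blast
    then show ?thesis using edge[of e x] edge[of f x] ef(1-3) by (metis nat.inject)
  qed
  moreover have "coloring (Inl v) \<noteq> coloring (Inr e)" if "v < n" "e \<in> edges" "v \<in> e" for v e
    using vertex[of v] edge[of e v] that by (metis nat.inject)
  ultimately show ?thesis
    unfolding total_coloring_def by auto
qed

text \<open>Stepping to smaller neighbors leads from every vertex down to \<open>0\<close>.\<close>

lemma connected_graph_edges:
  assumes "n > 0" and smaller: "\<And>w. 0 < w \<Longrightarrow> w < n \<Longrightarrow> \<exists>i<4. N i w < w"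
  shows "connected_graph {..<n} edges"
proof -
  define R where "R = {(x, y). {x, y} \<in> edges}"
  have sym: "sym (R\<^sup>*)"
    by (rule sym_rtrancl) (auto simp: R_def sym_def insert_commute)
  have zero: "(w, 0) \<in> R\<^sup>*" if "w < n" for w
    using that
  proof (induction w rule: less_induct)
    case (less w)
    show ?case
    proof (cases "w = 0")
      case False
      then obtain i where i: "i < 4" "N i w < w" using smaller[of w] less.prems by auto
      then have "{w, N i w} \<in> involution_edges n (N i)"
        unfolding involution_edges_def using less.prems by (intro CollectI exI[of _ w]) simp
      then have "(w, N i w) \<in> R" using i(1) by (auto simp only: R_def edges_def)
      moreover have "(N i w, 0) \<in> R\<^sup>*" using less.IH[OF i(2)] less.prems i(2) by simp
      ultimately show ?thesis by (rule converse_rtrancl_into_rtrancl)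
    qed simp
  qed
  have "(u, v) \<in> R\<^sup>*" if "u < n" "v < n" for u v
    using zero[OF that(1)] symD[OF sym zero[OF that(2)]] by (rule rtrancl_trans)
  then show ?thesis
    using assms(1) by (auto simp: connected_graph_def R_def)
qed

end

section \<open>Joining two colored graphs along an edge\<close>

text \<open>\<open>u v\<close> is the edge at which a further graph is inserted. Every vertex other than \<open>0\<close> has a
  smaller neighbor, which witnesses connectedness; for \<open>u\<close> and \<open>v\<close> it is not reached through the
  edge \<open>u v\<close>, so that it survives the insertion.\<close>

locale joinable = coloring_involutions +
  fixes u v :: nat
  assumes u_less: "u < n" and v_less: "v < n"
    and edge: "N 3 u = v" and color_u: "N 0 u = u" and color_v: "N 1 v = v"
    and smaller_neighbor: "0 < w \<Longrightarrow> w < n \<Longrightarrow> \<exists>i<4. N i w < w \<and> (w = u \<or> w = v \<longrightarrow> i \<noteq> 3)"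

definition join :: "nat \<Rightarrow> (nat \<Rightarrow> nat \<Rightarrow> nat) \<Rightarrow> nat \<Rightarrow> nat \<Rightarrow> (nat \<Rightarrow> nat \<Rightarrow> nat) \<Rightarrow> nat \<Rightarrow> nat \<Rightarrow> nat \<Rightarrow> nat"
  where "join n N u v H y i w =
    (if w < n then
       if i = 3 \<and> w = u then n else if i = 3 \<and> w = v then n + y else N i w
     else
       if i = 3 \<and> w = n then u else if i = 3 \<and> w = n + y then v else n + H i (w - n))"

lemma less_add_cases:
  fixes w n m :: nat
  assumes "w < n + m"
  obtains "w < n" | k where "w = n + k" "k < m"
  using assms by (metis add_less_cancel_left le_Suc_ex not_le)

text \<open>The new edges run from \<open>u\<close> to \<open>n\<close> (the copy of
  \<open>0\<close>) and from \<open>v\<close> to \<open>n + y\<close>. In \<open>H\<close> the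
  vertex \<open>y\<close> has color \<open>0\<close> and the vertex \<open>0\<close> has color
  \<open>1\<close>, so the ends of both new edges again have the colors \<open>0\<close> and
  \<open>1\<close>. The second of these edges is the place for the next insertion.\<close>

lemma joinable_join:
  assumes "joinable n N u v" and "joinable m H y 0"
  shows "joinable (n + m) (join n N u v H y) (n + y) v"
proof -
  interpret A: joinable n N u v by fact
  interpret B: joinable m H y 0 by fact
  have uv: "u \<noteq> v" using A.distinct_colors[of 0 1 u] A.color_u A.color_v A.u_less by auto
  have y: "y \<noteq> 0" using B.distinct_colors[of 0 1 y] B.color_u B.color_v B.u_less by (cases "y = 0") auto
  have v3: "N 3 v = u" using A.involution[of 3 u] A.edge A.u_less by auto
  have y3: "H 3 0 = y" using B.involution[of 3 y] B.edge B.u_less by auto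
  have three: "(3::nat) < 4" by simp
  let ?J = "join n N u v H y"
  have old: "?J i w = (if i = 3 \<and> w = u then n else if i = 3 \<and> w = v then n + y else N i w)"
    if "w < n" for i w
    using that by (simp add: join_def)
  have new: "?J i (n + k) = (if i = 3 \<and> k = 0 then u else if i = 3 \<and> k = y then v else n + H i k)" for i k
    by (simp add: join_def)
  have J3: "?J 3 u = n" "?J 3 v = n + y" "?J 3 n = u" "?J 3 (n + y) = v"
    using uv y A.u_less A.v_less by (simp_all add: join_def)
  have same_old: "?J i w = N i w" if "w < n" "\<not> (i = 3 \<and> (w = u \<or> w = v))" for i w
    using that by (auto simp: old)
  have same_new: "?J i (n + k) = n + H i k" if "\<not> (i = 3 \<and> (k = 0 \<or> k = y))" for i k
    using that by (auto simp: new)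
  \<comment> \<open>Color \<open>3\<close> pairs the ends of each removed edge with each other, so
    it never leads from another vertex to one of them, and unchanged values stay unchanged when
    \<open>?J\<close> is applied again.\<close>
  have N3: "N 3 w = u \<longleftrightarrow> w = v" "N 3 w = v \<longleftrightarrow> w = u" if "w < n" for w
    using A.involution[OF three that] A.edge v3 by metis+
  have H3: "H 3 k = 0 \<longleftrightarrow> k = y" "H 3 k = y \<longleftrightarrow> k = 0" if "k < m" for k
    using B.involution[OF three that] B.edge y3 by metis+
  \<comment> \<open>The rewired vertices are moved by color \<open>3\<close> both before and after,
    so vertex colors do not change.\<close>
  have fix_old: "?J i w = w \<longleftrightarrow> N i w = w" if "w < n" for i w
    using that uv v3 A.edge by (auto simp: old)
  have fix_new: "?J i (n + k) = n + k \<longleftrightarrow> H i k = k" for i k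
    using y y3 B.edge A.u_less A.v_less by (auto simp: new)
  show ?thesis
  proof
    show "?J i w < n + m" if "i < 4" "w < n + m" for i w
      using that(2) by (cases rule: less_add_cases)
        (use that(1) A.bounded[of i w] B.bounded[of i] A.u_less A.v_less B.u_less B.v_less
          in \<open>auto simp: old new\<close>)
    show "?J i (?J i w) = w" if "i < 4" "w < n + m" for i w
      using that(2)
    proof (cases rule: less_add_cases)
      case 1
      consider "i = 3" "w = u" | "i = 3" "w = v" | "\<not> (i = 3 \<and> (w = u \<or> w = v))" by blast
      then show ?thesis
      proof cases
        case 3
        then have "\<not> (i = 3 \<and> (N i w = u \<or> N i w = v))" using N3[OF 1] by blast
        from same_old[OF A.bounded[OF that(1) 1] this] show ?thesis
          using same_old[OF 1 3] A.involution[OF that(1) 1] by simp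
      qed (simp_all add: J3)
    next
      case (2 k)
      consider "i = 3" "k = 0" | "i = 3" "k = y" | "\<not> (i = 3 \<and> (k = 0 \<or> k = y))" by blast
      then show ?thesis
      proof cases
        case 3
        then have "\<not> (i = 3 \<and> (H i k = 0 \<or> H i k = y))" using H3[OF 2(2)] by blast
        from same_new[OF this] show ?thesis
          using same_new[OF 3] B.involution[OF that(1) 2(2)] 2(1) by simp
      qed (simp_all add: J3 2(1))
    qed
    show "\<exists>i<4. ?J i w = w" if "w < n + m" for w
      using that
      by (cases rule: less_add_cases) (simp_all add: fix_old fix_new A.ex_fixing B.ex_fixing)
    show "i = j" if ij: "i < 4" "j < 4" and w: "w < n + m" and eq: "?J i w = ?J j w" for i j w
      using w
    proof (cases rule: less_add_cases)
      case 1
      \<comment> \<open>A rewired value lies on the other side of \<open>n\<close> and so never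
        equals an unchanged one.\<close>
      have "N i w = N j w \<longrightarrow> i = j" using A.distinct_colors[OF ij 1] by blast
      then show ?thesis
        using eq A.bounded[OF ij(1) 1] A.bounded[OF ij(2) 1] unfolding old[OF 1]
        by (simp split: if_splits)
    next
      case (2 k)
      have "H i k = H j k \<longrightarrow> i = j" using B.distinct_colors[OF ij 2(2)] by blast
      then show ?thesis
        using eq A.u_less A.v_less unfolding 2(1) new
        by (simp split: if_splits)
    qed
    show "i = j"
      if ij: "i < 4" "j < 4" and w: "w < n + m" and eq: "?J i w = w" "?J i (?J j w) = ?J j w" for i j w
      using w
    proof (cases rule: less_add_cases)
      case 1
      then have i: "N i w = w" using eq fix_old by simp
      consider "j = 3" "w = u" | "j = 3" "w = v" | "?J j w = N j w"
        using old[OF 1, of j] by presburger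
      then show ?thesis
      proof cases
        case 1
        \<comment> \<open>The new neighbor of \<open>u\<close> is the copy of \<open>0\<close>,
          whose color is \<open>1\<close>, while \<open>u\<close> has color \<open>0\<close>. The
          other three ends are treated alike.\<close>
        then have "i = 0" using A.distinct_colors[of i 0 u] i A.color_u A.u_less ij by auto
        moreover have "H i 0 = 0" using eq 1 fix_new[of i 0] by (simp add: J3)
        ultimately show ?thesis using B.distinct_colors[of 0 1 0] B.color_v B.v_less by auto
      next
        case 2
        then have "i = 1" using A.distinct_colors[of i 1 v] i A.color_v A.v_less ij by auto
        moreover have "H i y = y" using eq 2 fix_new[of i y] by (simp add: J3)
        ultimately show ?thesis using B.distinct_colors[of 0 1 y] B.color_u B.u_less by auto
      next
        case 3
        then show ?thesis using A.proper[OF ij 1 i] eq fix_old A.bounded[OF ij(2) 1] by simp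
      qed
    next
      case (2 k)
      then have i: "H i k = k" using eq fix_new by simp
      consider "j = 3" "k = 0" | "j = 3" "k = y" | "?J j w = n + H j k"
        using new[of j k] 2(1) by presburger
      then show ?thesis
      proof cases
        case 1
        then have "i = 1" using B.distinct_colors[of i 1 0] i B.color_v B.v_less ij by auto
        moreover have "N i u = u" using eq 1 2 A.u_less fix_old[of u i] by (simp add: J3)
        ultimately show ?thesis using A.distinct_colors[of 0 1 u] A.color_u A.u_less by auto
      next
        case c: 2
        then have "i = 0" using B.distinct_colors[of i 0 y] i B.color_u B.u_less ij by auto
        moreover have "N i v = v" using eq c 2 A.v_less fix_old[of v i] by (simp add: J3)
        ultimately show ?thesis using A.distinct_colors[of 0 1 v] A.color_v A.v_less by auto
      next
        case 3
        then show ?thesis using B.proper[OF ij 2(2) i] eq fix_new by simp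
      qed
    qed
    show "n + y < n + m" "v < n + m" using B.u_less A.v_less by auto
    show "?J 3 (n + y) = v" using y by (simp add: new)
    show "?J 0 (n + y) = n + y" using B.color_u by (simp add: fix_new)
    show "?J 1 v = v" using A.color_v A.v_less by (simp add: fix_old)
    show "\<exists>i<4. ?J i w < w \<and> (w = n + y \<or> w = v \<longrightarrow> i \<noteq> 3)" if w: "0 < w" "w < n + m" for w
      using w(2)
    proof (cases rule: less_add_cases)
      case 1
      \<comment> \<open>The neighbor survives the rewiring because at \<open>u\<close> and
        \<open>v\<close> it is reached by a color other than \<open>3\<close>.\<close>
      then obtain i where "i < 4" "N i w < w" "w = u \<or> w = v \<longrightarrow> i \<noteq> 3"
        using A.smaller_neighbor w(1) by blast
      then show ?thesis using 1 by (intro exI[of _ i]) (auto simp: old)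
    next
      case (2 k)
      \<comment> \<open>Within the copy of \<open>H\<close> only \<open>n\<close> has no smaller
        neighbor; the new edge to \<open>u\<close> supplies one. This is why the inserted graph must
        have \<open>0\<close> as an end of its removed edge.\<close>
      show ?thesis
      proof (cases "k = 0")
        case True
        then show ?thesis using 2 y A.u_less A.v_less new[of 3 0] by (intro exI[of _ 3]) auto
      next
        case False
        then obtain i where "i < 4" "H i k < k" "k = y \<longrightarrow> i \<noteq> 3"
          using B.smaller_neighbor[of k] 2 by auto
        then show ?thesis using 2 False A.v_less by (intro exI[of _ i]) (auto simp: new)
      qed
    qed
  qed
qed

text \<open>Only color \<open>3\<close> at the four rewired vertices changes, and it fixes none of
  them before or after.\<close>

lemma card_fixed_points_join:
  assumes "joinable n N u v" and "joinable m H y 0"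
  shows "card (fixed_points (n + m) (join n N u v H y i))
    = card (fixed_points n (N i)) + card (fixed_points m (H i))"
proof -
  interpret A: joinable n N u v by fact
  interpret B: joinable m H y 0 by fact
  have "N 3 u \<noteq> u" "N 3 v \<noteq> v"
    using A.distinct_colors[of 0 3 u] A.distinct_colors[of 1 3 v]
      A.color_u A.color_v A.u_less A.v_less by auto
  moreover have "H 3 0 \<noteq> 0" "H 3 y \<noteq> y"
    using B.distinct_colors[of 1 3 0] B.distinct_colors[of 0 3 y]
      B.color_u B.color_v B.u_less B.v_less by auto
  ultimately have "fixed_points (n + m) (join n N u v H y i)
      = fixed_points n (N i) \<union> (+) n ` fixed_points m (H i)"
    using A.u_less A.v_less
    by (auto simp: fixed_points_def join_def elim!: less_add_cases split: if_splits)
  moreover have "card ((+) n ` fixed_points m (H i)) = card (fixed_points m (H i))"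
    by (rule card_image) simp
  moreover have "fixed_points n (N i) \<inter> (+) n ` fixed_points m (H i) = {}"
    by (auto simp: fixed_points_def)
  moreover have "finite (fixed_points n (N i))" "finite (fixed_points m (H i))"
    by (simp_all add: fixed_points_def)
  ultimately show ?thesis
    by (simp add: card_Un_disjoint)
qed

section \<open>The prism and the initial graphs\<close>

text \<open>The triangles are 0 1 3 and 2 4 5. Color \<open>2\<close> is the perfect matching
  between them and so has no fixed point.\<close>

definition prism :: "nat \<Rightarrow> nat \<Rightarrow> nat" where
  "prism i w = [[1,0,2,3,5,4], [0,3,5,1,4,2], [2,4,0,5,1,3], [3,1,4,0,2,5]] ! i ! w"

text \<open>Two copies of K4 minus an edge, on 0 2 3 6 and 1 4 5 7, closed to a ring by the edges 0
  1 and 6 7.\<close>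

definition graph8 :: "nat \<Rightarrow> nat \<Rightarrow> nat" where
  "graph8 i w = [[0,4,3,2,1,7,6,5], [1,0,6,3,7,5,2,4], [2,1,0,6,5,4,3,7], [3,5,2,0,4,1,7,6]] ! i ! w"

text \<open>K4 with three vertices replaced by the triangles 0 2 3, 1 4 5 and 7 8 9; the fourth
  vertex is 6.\<close>

definition graph10 :: "nat \<Rightarrow> nat \<Rightarrow> nat" where
  "graph10 i w = [[0,4,3,2,1,5,6,7,9,8], [2,1,0,3,6,8,4,9,5,7], [1,0,2,7,5,4,9,3,8,6],
     [3,5,6,0,4,1,2,8,7,9]] ! i ! w"

section \<open>Checking the tables by evaluation\<close>

lemma all_less_upt: "(\<forall>i<n. P i) \<longleftrightarrow> list_all P [0..<n]"
  by (auto simp: list_all_iff)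

lemma ex_less_upt: "(\<exists>i<n. P i) \<longleftrightarrow> list_ex P [0..<n]"
  by (auto simp: list_ex_iff)

text \<open>With every quantifier bounded, the conditions become decidable by evaluation for a
  concrete table.\<close>

lemma joinableI:
  assumes "\<forall>i<4. \<forall>w<n. N i w < n \<and> N i (N i w) = w"
    and "\<forall>w<n. \<exists>i<4. N i w = w"
    and "\<forall>i<4. \<forall>j<4. \<forall>w<n. N i w = N j w \<longrightarrow> i = j"
    and "\<forall>i<4. \<forall>j<4. \<forall>w<n. N i w = w \<longrightarrow> N i (N j w) = N j w \<longrightarrow> i = j"
    and "u < n \<and> v < n \<and> N 3 u = v \<and> N 0 u = u \<and> N 1 v = v"
    and "\<forall>w<n. 0 < w \<longrightarrow> (\<exists>i<4. N i w < w \<and> (w = u \<or> w = v \<longrightarrow> i \<noteq> 3))"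
  shows "joinable n N u v"
proof
  show "N i w < n" "N i (N i w) = w" if "i < 4" "w < n" for i w
    using assms(1) that by simp_all
  show "\<exists>i<4. N i w = w" if "w < n" for w
    using assms(2) that by simp
  show "i = j" if "i < 4" "j < 4" "w < n" "N i w = N j w" for i j w
    using assms(3)[rule_format, OF that] .
  show "i = j" if "i < 4" "j < 4" "w < n" "N i w = w" "N i (N j w) = N j w" for i j w
    using assms(4)[rule_format, OF that] .
  show "\<exists>i<4. N i w < w \<and> (w = u \<or> w = v \<longrightarrow> i \<noteq> 3)" if "0 < w" "w < n" for w
    using assms(6) that by blast
qed (use assms(5) in blast)+

lemma fixed_points_upt: "card (fixed_points n f) = length (filter (\<lambda>w. f w = w) [0..<n])"
proof -
  have "fixed_points n f = set (filter (\<lambda>w. f w = w) [0..<n])"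
    by (auto simp: fixed_points_def)
  then show ?thesis by (simp add: distinct_card del: set_filter)
qed

lemma joinable_prism: "joinable 6 prism 3 0"
  by (rule joinableI, unfold all_less_upt ex_less_upt prism_def, code_simp+)

lemma joinable_graph8: "joinable 8 graph8 0 3"
  by (rule joinableI, unfold all_less_upt ex_less_upt graph8_def, code_simp+)

lemma joinable_graph10: "joinable 10 graph10 0 3"
  by (rule joinableI, unfold all_less_upt ex_less_upt graph10_def, code_simp+)

lemma card_fixed_points_prism:
  "card (fixed_points 6 (prism 0)) = 2" "card (fixed_points 6 (prism 2)) = 0"
  unfolding fixed_points_upt prism_def by code_simp+

lemma card_fixed_points_graph8:
  "card (fixed_points 8 (graph8 0)) = 2" "card (fixed_points 8 (graph8 2)) = 2"
  unfolding fixed_points_upt graph8_def by code_simp+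

lemma card_fixed_points_graph10:
  "card (fixed_points 10 (graph10 0)) = 4" "card (fixed_points 10 (graph10 2)) = 2"
  unfolding fixed_points_upt graph10_def by code_simp+

section \<open>Attaching prisms to reach every even order\<close>

lemma join_prisms:
  assumes "joinable n N u v"
  shows "\<exists>M a b. joinable (n + 6 * k) M a b \<and>
    card (fixed_points (n + 6 * k) (M 0)) + card (fixed_points n (N 2))
      = card (fixed_points (n + 6 * k) (M 2)) + card (fixed_points n (N 0)) + 2 * k"
proof (induction k)
  case 0
  then show ?case using assms by (intro exI[of _ N] exI[of _ u] exI[of _ v]) simp
next
  case (Suc k)
  then obtain M a b where M: "joinable (n + 6 * k) M a b"
    and c: "card (fixed_points (n + 6 * k) (M 0)) + card (fixed_points n (N 2))
      = card (fixed_points (n + 6 * k) (M 2)) + card (fixed_points n (N 0)) + 2 * k"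
    by blast
  let ?J = "join (n + 6 * k) M a b prism 3"
  have Suc_k: "n + 6 * Suc k = n + 6 * k + 6" by simp
  \<comment> \<open>A prism contributes 2 fixed points to color \<open>0\<close> and none to color
    \<open>2\<close>. The balance is kept as an equation of sums to avoid truncated
    subtraction.\<close>
  have "card (fixed_points (n + 6 * k + 6) (?J 0)) + card (fixed_points n (N 2))
      = card (fixed_points (n + 6 * k + 6) (?J 2)) + card (fixed_points n (N 0)) + 2 * Suc k"
    using c unfolding card_fixed_points_join[OF M joinable_prism] card_fixed_points_prism by simp
  then show ?case
    unfolding Suc_k using joinable_join[OF M joinable_prism] by blast
qed

lemma ex_unbalanced_join:
  assumes "joinable n N u v"
    and "card (fixed_points n (N 2)) + 4 \<le> card (fixed_points n (N 0)) + 2 * k"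
  shows "\<exists>M a b. joinable (n + 6 * k) M a b \<and>
    card (fixed_points (n + 6 * k) (M 2)) + 4 \<le> card (fixed_points (n + 6 * k) (M 0))"
proof -
  obtain M a b where M: "joinable (n + 6 * k) M a b"
    and "card (fixed_points (n + 6 * k) (M 0)) + card (fixed_points n (N 2))
      = card (fixed_points (n + 6 * k) (M 2)) + card (fixed_points n (N 0)) + 2 * k"
    using join_prisms[OF assms(1)] by blast
  then have "card (fixed_points (n + 6 * k) (M 2)) + 4 \<le> card (fixed_points (n + 6 * k) (M 0))"
    using assms(2) by linarith
  then show ?thesis using M by blast
qed

lemma ex_unbalanced:
  fixes n :: nat
  assumes "even n" "n \<ge> 16"
  shows "\<exists>N u v. joinable n N u v \<and> card (fixed_points n (N 2)) + 4 \<le> card (fixed_points n (N 0))"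
proof -
  \<comment> \<open>The residue of \<open>n\<close> modulo 6 selects the initial graph. The one of
    order 8 starts with gap 0 and needs two prisms; the others start with gap 2 and need
    one.\<close>
  have "\<exists>k. n = 6 + 6 * k \<and> k \<ge> 1 \<or> n = 8 + 6 * k \<and> k \<ge> 2 \<or> n = 10 + 6 * k \<and> k \<ge> 1"
    using assms by presburger
  then consider k where "n = 6 + 6 * k" "k \<ge> 1" | k where "n = 8 + 6 * k" "k \<ge> 2"
    | k where "n = 10 + 6 * k" "k \<ge> 1"
    by blast
  then show ?thesis
  proof cases
    case (1 k)
    show ?thesis
      unfolding 1(1)
      by (rule ex_unbalanced_join[OF joinable_prism]) (use 1(2) in \<open>simp add: card_fixed_points_prism\<close>)
  next
    case (2 k)
    show ?thesis
      unfolding 2(1)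
      by (rule ex_unbalanced_join[OF joinable_graph8]) (use 2(2) in \<open>simp add: card_fixed_points_graph8\<close>)
  next
    case (3 k)
    show ?thesis
      unfolding 3(1)
      by (rule ex_unbalanced_join[OF joinable_graph10]) (use 3(2) in \<open>simp add: card_fixed_points_graph10\<close>)
  qed
qed

theorem theorem6p2:
  fixes n :: nat
  assumes "even n" and "n \<ge> 16"
  shows "\<exists>(V :: nat set) (E :: nat set set) (c :: nat + nat set \<Rightarrow> nat).
           cubic_graph V E \<and> connected_graph V E \<and> card V = n \<and>
           total_coloring 4 V E c \<and> \<not> equitable 4 V E c"
proof -
  obtain N u v where J: "joinable n N u v"
    and f: "card (fixed_points n (N 2)) + 4 \<le> card (fixed_points n (N 0))"
    using ex_unbalanced[OF assms] by blast
  interpret joinable n N u v by (fact J)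
  have "connected_graph {..<n} edges"
  proof (rule connected_graph_edges)
    show "\<exists>i<4. N i w < w" if "0 < w" "w < n" for w
      using smaller_neighbor[OF that] by blast
  qed (use assms(2) in simp)
  then show ?thesis
    using cubic_graph_edges total_coloring_edges not_equitable_coloring[OF f]
    by (intro exI[of _ "{..<n}"] exI[of _ edges] exI[of _ coloring]) simp
qed

end
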